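(* Let $G$ be a finite simple graph with $n$ vertices and let $D$ be an orientation of $G$ with $F(D)=\mathrm{MOF}(G)$. If $H$ is an induced subgraph of $D$ (an induced subgraph of $G$ on a nonempty vertex set, with the orientation inherited from $D$), then \[ \mathrm{MOF}(G)\leq F(H)+n-|H|\leq \mathrm{MOF}(H)+n-|H|, \] where $|H|$ is the number of vertices of $H$ and $\mathrm{MOF}(H)$ refers to the underlying simple graph of $H$.
   Context: An orientation $D$ of a simple graph $G$ assigns to each edge exactly one direction; if $(u,v)$ is an arc, $v$ is an out-neighbor of $u$. Oriented $1$-forcing: starting from a nonempty set $S$ of colored vertices, repeatedly, any colored vertex with at most one non-colored out-neighbor forces that out-neighbor to become colored (all forcings in a step simultaneous), until no change occurs; $S$ is a forcing set if all vertices end up colored. $F(D)$ is the minimum size of a forcing set of the oriented graph $D$, and $\mathrm{MOF}(G)$ is the maximum of $F(D)$ over all orientations $D$ of $G$. *)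

theory Defs
  imports "Graph_Theory.Digraph_Component"
begin

text \<open>
  A finite simple graph is a \<^locale>\<open>pair_graph\<close>: a finite symmetric loopfree relation on
  its vertex set, so an undirected edge is a pair of opposite arcs. An orientation keeps exactly
  one arc of each such pair.
\<close>

definition orientation :: "'a pair_pre_digraph \<Rightarrow> 'a pair_pre_digraph \<Rightarrow> bool" where
  "orientation D G \<longleftrightarrow>
     pverts D = pverts G \<and> parcs D \<subseteq> parcs G \<and>
     (\<forall>u v. (u, v) \<in> parcs G \<longrightarrow> ((u, v) \<in> parcs D) \<noteq> ((v, u) \<in> parcs D))"

definition noncolored_out :: "'a pair_pre_digraph \<Rightarrow> 'a set \<Rightarrow> 'a \<Rightarrow> 'a set" where
  "noncolored_out D C u = {v. (u, v) \<in> parcs D \<and> v \<notin> C}"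

text \<open>
  One simultaneous round of forcings. The digraphs of interest are finite, so \<^const>\<open>card\<close>
  is the true number of non-colored out-neighbors.
\<close>

definition force_step :: "'a pair_pre_digraph \<Rightarrow> 'a set \<Rightarrow> 'a set" where
  "force_step D C =
     C \<union> {v. \<exists>u\<in>C. card (noncolored_out D C u) \<le> 1 \<and> v \<in> noncolored_out D C u}"

text \<open>
  The colored sets increase from round to round and never leave the vertex set, so the process
  stabilizes with all vertices colored iff some round has all vertices colored.
\<close>

definition forcing_set :: "'a pair_pre_digraph \<Rightarrow> 'a set \<Rightarrow> bool" where
  "forcing_set D S \<longleftrightarrow>
     S \<noteq> {} \<and> S \<subseteq> pverts D \<and> (\<exists>t. (force_step D ^^ t) S = pverts D)"

definition forcing_number :: "'a pair_pre_digraph \<Rightarrow> nat" where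
  "forcing_number D = Min (card ` {S. forcing_set D S})"

definition MOF :: "'a pair_pre_digraph \<Rightarrow> nat" where
  "MOF G = Max (forcing_number ` {D. orientation D G})"

end

(* A forcing set of the induced subgraph H stays forcing in D once all vertices outside H are
   coloured: these extra vertices never count as non-coloured out-neighbours, so every force that is
   possible in H is possible in D. *)
theory Submission
  imports Defs
begin

lemma force_step_increasing: "C \<subseteq> force_step D C"
  by (auto simp: force_step_def)

text \<open>Used twice: in H it keeps every round inside \<open>pverts H\<close>, as
  \<open>force_step_induced\<close> requires, and in D it gives the inclusion that turns full
  coverage into equality.\<close>

lemma force_step_iterate_subset_pverts:
  assumes "pair_wf_digraph D" and "C \<subseteq> pverts D"
  shows "(force_step D ^^ t) C \<subseteq> pverts D"
proof (induction t)
  case 0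
  then show ?case using assms(2) by simp
next
  case (Suc t)
  then show ?case
    using pair_wf_digraph.in_arcsD2[OF assms(1)]
    by (auto simp: force_step_def noncolored_out_def)
qed

text \<open>Coloured vertices outside H may themselves force vertices of H, so D can run ahead of H.
  Allowing any superset \<open>C'\<close> instead of the exact union lets this serve as the
  induction step over rounds.\<close>

lemma force_step_induced:
  assumes "pair_fin_digraph D"
    and arcs: "parcs H = {(u, v) \<in> parcs D. u \<in> pverts H \<and> v \<in> pverts H}"
    and C: "C \<subseteq> pverts H"
    and C': "C \<union> (pverts D - pverts H) \<subseteq> C'"
  shows "force_step H C \<union> (pverts D - pverts H) \<subseteq> force_step D C'"
proof
  interpret D: pair_fin_digraph D by fact
  fix v assume v: "v \<in> force_step H C \<union> (pverts D - pverts H)"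
  show "v \<in> force_step D C'"
  proof (cases "v \<in> C'")
    case True
    then show ?thesis by (rule subsetD[OF force_step_increasing])
  next
    case False
    \<comment> \<open>All vertices outside H lie in \<open>C'\<close>, so \<open>v\<close> is one
      that H colours in this very round.\<close>
    with v C' have "v \<in> force_step H C" "v \<notin> C" by blast+
    then obtain u where u: "u \<in> C" "card (noncolored_out H C u) \<le> 1"
      "v \<in> noncolored_out H C u"
      unfolding force_step_def by blast
    have "noncolored_out H C u \<subseteq> pverts D"
      using D.in_arcsD2 by (auto simp: noncolored_out_def arcs)
    then have "finite (noncolored_out H C u)"
      using D.pair_finite_verts finite_subset by blast
    \<comment> \<open>An out-neighbour of \<open>u\<close> in D that avoids \<open>C'\<close> must
      lie in H; since \<open>u\<close> lies in H too and H is induced, the arc belongs to H.\<close>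
    moreover have "noncolored_out D C' u \<subseteq> noncolored_out H C u"
      using C C' u(1) by (auto simp: noncolored_out_def arcs dest: D.in_arcsD2)
    ultimately have "card (noncolored_out D C' u) \<le> 1"
      using u(2) card_mono le_trans by blast
    moreover have "v \<in> noncolored_out D C' u"
      using u(3) False by (auto simp: noncolored_out_def arcs)
    moreover have "u \<in> C'" using u(1) C' by blast
    ultimately show ?thesis unfolding force_step_def by blast
  qed
qed

lemma forcing_set_extend_induced:
  assumes fin: "pair_fin_digraph D"
    and sub: "pverts H \<subseteq> pverts D"
    and arcs: "parcs H = {(u, v) \<in> parcs D. u \<in> pverts H \<and> v \<in> pverts H}"
    and S: "forcing_set H S"
  shows "forcing_set D (S \<union> (pverts D - pverts H))"
proof -
  let ?T = "S \<union> (pverts D - pverts H)"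
  interpret D: pair_fin_digraph D by fact
  have H: "pair_wf_digraph H"
    by unfold_locales (auto simp: arcs)
  obtain t where t: "(force_step H ^^ t) S = pverts H" and S': "S \<noteq> {}" "S \<subseteq> pverts H"
    using S by (auto simp: forcing_set_def)
  \<comment> \<open>The two processes are compared round by round, so the \<open>t\<close> that
    works for H also works for D.\<close>
  have "(force_step H ^^ k) S \<union> (pverts D - pverts H) \<subseteq> (force_step D ^^ k) ?T" for k
  proof (induction k)
    case 0
    then show ?case by simp
  next
    case (Suc k)
    show ?case
      using force_step_induced[OF fin arcs force_step_iterate_subset_pverts[OF H S'(2)] Suc]
      by simp
  qed
  from this[of t] have "pverts D \<subseteq> (force_step D ^^ t) ?T" using t by auto
  moreover have "?T \<subseteq> pverts D" using S' sub by auto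
  ultimately show ?thesis
    using force_step_iterate_subset_pverts[OF D.pair_wf_digraph_axioms, of ?T t] S'(1)
    unfolding forcing_set_def by blast
qed

lemma finite_forcing_sets:
  "finite (pverts D) \<Longrightarrow> finite {S. forcing_set D S}"
  by (rule finite_subset[of _ "Pow (pverts D)"]) (auto simp: forcing_set_def)

lemma forcing_number_le:
  "finite (pverts D) \<Longrightarrow> forcing_set D S \<Longrightarrow> forcing_number D \<le> card S"
  unfolding forcing_number_def by (intro Min_le) (auto simp: finite_forcing_sets)

text \<open>The full vertex set, being nonempty, is forcing after zero rounds, so \<open>Min\<close>
  is taken over a nonempty finite set.\<close>

lemma forcing_number_attained:
  assumes "finite (pverts D)" and "pverts D \<noteq> {}"
  obtains S where "forcing_set D S" and "card S = forcing_number D"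
proof -
  have "(force_step D ^^ 0) (pverts D) = pverts D" by simp
  then have "forcing_set D (pverts D)"
    using assms(2) unfolding forcing_set_def by blast
  then have "forcing_number D \<in> card ` {S. forcing_set D S}"
    unfolding forcing_number_def
    by (intro Min_in finite_imageI finite_forcing_sets assms(1)) auto
  then show ?thesis using that by auto
qed

lemma forcing_number_le_induced:
  assumes fin: "pair_fin_digraph D"
    and sub: "pverts H \<subseteq> pverts D" and ne: "pverts H \<noteq> {}"
    and arcs: "parcs H = {(u, v) \<in> parcs D. u \<in> pverts H \<and> v \<in> pverts H}"
  shows "forcing_number D \<le> forcing_number H + (card (pverts D) - card (pverts H))"
proof -
  have finD: "finite (pverts D)" by (rule pair_fin_digraph.pair_finite_verts[OF fin])
  then have finH: "finite (pverts H)" using sub finite_subset by blast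
  obtain S where S: "forcing_set H S" "card S = forcing_number H"
    using forcing_number_attained[OF finH ne] .
  have "forcing_number D \<le> card (S \<union> (pverts D - pverts H))"
    by (rule forcing_number_le[OF finD forcing_set_extend_induced[OF fin sub arcs S(1)]])
  also have "\<dots> \<le> card S + card (pverts D - pverts H)" by (rule card_Un_le)
  also have "\<dots> = forcing_number H + (card (pverts D) - card (pverts H))"
    using S(2) card_Diff_subset[OF finH sub] by simp
  finally show ?thesis .
qed

text \<open>The vertex set is fixed, so an orientation is determined by its arc set, a subset of
  \<open>parcs G\<close>. This makes the \<open>Max\<close> in \<open>MOF\<close> a genuine
  maximum.\<close>

lemma finite_orientations:
  assumes "finite (parcs G)"
  shows "finite {D :: 'a pair_pre_digraph. orientation D G}"
proof (rule finite_subset)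
  show "{D. orientation D G} \<subseteq> (\<lambda>A. \<lparr>pverts = pverts G, parcs = A\<rparr>) ` Pow (parcs G)"
  proof
    fix D :: "'a pair_pre_digraph" assume "D \<in> {D. orientation D G}"
    then have "D = \<lparr>pverts = pverts G, parcs = parcs D\<rparr>" "parcs D \<in> Pow (parcs G)"
      by (auto simp: orientation_def)
    then show "D \<in> (\<lambda>A. \<lparr>pverts = pverts G, parcs = A\<rparr>) ` Pow (parcs G)" by blast
  qed
qed (simp add: assms)

lemma forcing_number_le_MOF:
  "finite (parcs G) \<Longrightarrow> orientation D G \<Longrightarrow> forcing_number D \<le> MOF G"
  unfolding MOF_def by (intro Max_ge) (auto simp: finite_orientations)

text \<open>Here \<open>mk_symmetric\<close> yields the underlying graph of H. The case
  \<open>u = v\<close> of the assumption also excludes loops.\<close>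

lemma orientation_mk_symmetric:
  assumes "\<And>u v. (u, v) \<in> parcs H \<Longrightarrow> (v, u) \<notin> parcs H"
  shows "orientation H (mk_symmetric (with_proj H))"
  using assms by (auto simp: orientation_def parcs_mk_symmetric)

theorem theorem3p19:
  fixes G D H :: "'a pair_pre_digraph" and n :: nat
  assumes "pair_graph G"
    and "n = card (pverts G)"
    and "orientation D G"
    and "forcing_number D = MOF G"
    and "induced_subgraph (with_proj H) (with_proj D)"
    and "pverts H \<noteq> {}"
  shows "MOF G \<le> forcing_number H + n - card (pverts H) \<and>
         forcing_number H + n - card (pverts H)
           \<le> MOF (mk_symmetric (with_proj H)) + n - card (pverts H)"
proof -
  interpret G: pair_graph G by fact
  have vD: "pverts D = pverts G" and aD: "parcs D \<subseteq> parcs G"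
    using assms(3) by (auto simp: orientation_def)
  have finD: "pair_fin_digraph D"
  proof
    show "finite (parcs D)" using aD G.pair_finite_arcs finite_subset by blast
  qed (use G.arc_fst_in_verts G.arc_snd_in_verts G.pair_finite_verts subsetD[OF aD] in
      \<open>simp_all add: vD\<close>)
  have sub: "pverts H \<subseteq> pverts D"
    and arcs: "parcs H = {(u, v) \<in> parcs D. u \<in> pverts H \<and> v \<in> pverts H}"
    using assms(5) by (auto simp: induced_subgraph_def subgraph_def)
  \<comment> \<open>Subtraction on naturals is truncated; this bound permits regrouping
    \<open>forcing_number H + (n - card (pverts H))\<close>.\<close>
  have le: "card (pverts H) \<le> n"
    using sub vD G.pair_finite_verts assms(2) by (simp add: card_mono)
  have "forcing_number D \<le> forcing_number H + (n - card (pverts H))"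
    using forcing_number_le_induced[OF finD sub assms(6) arcs] vD assms(2) by simp
  then have upper: "MOF G \<le> forcing_number H + n - card (pverts H)"
    using assms(4) le by simp
  have "parcs H \<subseteq> parcs D" using arcs by auto
  then have "finite (parcs H)"
    using pair_fin_digraph.pair_finite_arcs[OF finD] finite_subset by blast
  then have "finite (parcs (mk_symmetric (with_proj H)))"
    by (auto simp: parcs_mk_symmetric)
  moreover have "orientation H (mk_symmetric (with_proj H))"
  proof (rule orientation_mk_symmetric)
    fix u v assume "(u, v) \<in> parcs H"
    then have "(u, v) \<in> parcs D" "(u, v) \<in> parcs G" using \<open>parcs H \<subseteq> parcs D\<close> aD by blast+
    \<comment> \<open>D keeps exactly one of the two opposite arcs of an edge of G.\<close>
    then have "(v, u) \<notin> parcs D" using assms(3) unfolding orientation_def by blast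
    then show "(v, u) \<notin> parcs H" using \<open>parcs H \<subseteq> parcs D\<close> by blast
  qed
  ultimately have "forcing_number H \<le> MOF (mk_symmetric (with_proj H))"
    by (rule forcing_number_le_MOF)
  with upper show ?thesis by (simp add: diff_le_mono)
qed

end
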